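(* Let $(X_k)_{k\in\mathbb N}$ be a sequence of independent centered real random variables such that there is $c_0>0$ with $|X_k|\le c_0$ for all $k$, and there is $c_1>0$ with $\mathrm{Var}[X_k]=\mathbb E[X_k^2]\ge c_1$ for all $k$. Assume moreover: (i) there is a partition $\mathbb N=N_1\cup\dots\cup N_p$ such that for all $1\le i\le p$ and $k\in N_i$, the law of $X_k$ is independent of $k$, i.e. $X_k$ has the same distribution as a random variable $X^{(i)}$; write $\varphi_i(\lambda)=\mathbb E[\exp(\lambda X^{(i)})]$ for the corresponding moment generating function; (ii) for each $i$, the limit $d_i:=\lim_{n\to\infty}\frac1n\,\sharp\{1\le k\le n: k\in N_i\}$ exists. Then the sequence of empirical means $M_n=\frac1n\sum_{k=1}^nX_k$, $n\in\mathbb N$, satisfies an LDP with speed $n$ and good rate function $$\Lambda^*(x):=\sup_{\lambda\in\mathbb R}\big(\lambda x-\Lambda(\lambda)\big),\qquad x\in\mathbb R,$$ the Fenchel-Legendre transform of $$\Lambda(\lambda):=\sum_{i=1}^p d_i\log\varphi_i(\lambda),\qquad \lambda\in\mathbb R.$$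
   Context: A sequence of real random variables $(Z_n)_{n\in\mathbb N}$ satisfies the LDP (large deviation principle) with good rate function $I$ and speed $s(n)$ if: (i) $I:\mathbb R\to[0,\infty]$ is not infinite everywhere, and the level sets $\{x: I(x)\le c\}$, $c\in[0,\infty)$, are compact (in particular, $I$ is lower semi-continuous); (ii) $s(n)>0$ satisfies $\lim_{n\to\infty}s(n)=\infty$; (iii) for any Borel set $G\subseteq\mathbb R$, $$-I(\mathrm{int}(G))\le\liminf_{n\to\infty}\frac1{s(n)}\log\mathbb P[Z_n\in G]\le\limsup_{n\to\infty}\frac1{s(n)}\log\mathbb P[Z_n\in G]\le -I(\mathrm{cl}(G)),$$ where $I(A):=\inf_{x\in A}I(x)$ for $A\subseteq\mathbb R$ (with $\inf\emptyset=\infty$), $\mathrm{int}$ and $\mathrm{cl}$ denote interior and closure, and $\log 0=-\infty$. *)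

theory Defs
  imports "HOL-Probability.Probability"
begin

definition log_ereal :: "real \<Rightarrow> ereal" where
  "log_ereal p = (if p = 0 then -\<infinity> else ereal (ln p))"

text \<open>The bound \<open>0 \<le> I x\<close> encodes that the rate function is valued in \<open>[0,\<infinity>]\<close>.\<close>

definition good_rate_function :: "(real \<Rightarrow> ereal) \<Rightarrow> bool" where
  "good_rate_function I \<longleftrightarrow>
     (\<forall>x. 0 \<le> I x) \<and> (\<exists>x. I x \<noteq> \<infinity>) \<and> (\<forall>c::real. 0 \<le> c \<longrightarrow> compact {x. I x \<le> ereal c})"

text \<open>
  Sequences are indexed by the positive integers; the values of \<open>Z\<close> and \<open>s\<close> at \<open>0\<close> are irrelevant.
  The convention \<open>inf \<emptyset> = \<infinity>\<close> is that of the complete lattice of extended reals.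
\<close>

definition satisfies_LDP ::
  "'a measure \<Rightarrow> (nat \<Rightarrow> 'a \<Rightarrow> real) \<Rightarrow> (nat \<Rightarrow> real) \<Rightarrow> (real \<Rightarrow> ereal) \<Rightarrow> bool" where
  "satisfies_LDP M Z s I \<longleftrightarrow>
     (\<forall>n\<ge>1. Z n \<in> borel_measurable M) \<and>
     good_rate_function I \<and>
     (\<forall>n\<ge>1. 0 < s n) \<and> filterlim s at_top sequentially \<and>
     (\<forall>G\<in>sets borel.
        - (INF x\<in>interior G. I x)
          \<le> liminf (\<lambda>n. ereal (1 / s n) * log_ereal (measure M {\<omega> \<in> space M. Z n \<omega> \<in> G})) \<and>
        limsup (\<lambda>n. ereal (1 / s n) * log_ereal (measure M {\<omega> \<in> space M. Z n \<omega> \<in> G}))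
          \<le> - (INF x\<in>closure G. I x))"

definition mgf :: "'a measure \<Rightarrow> ('a \<Rightarrow> real) \<Rightarrow> real \<Rightarrow> real" where
  "mgf M X l = (\<integral>\<omega>. exp (l * X \<omega>) \<partial>M)"

definition fenchel_legendre :: "(real \<Rightarrow> real) \<Rightarrow> real \<Rightarrow> ereal" where
  "fenchel_legendre L x = (SUP l. ereal (l * x - L l))"

end

theory Submission
  imports Defs
begin

text \<open>
  Since all variables are bounded, \<open>\<Lambda>\<close> is finite and differentiable, so the theorem is an instance of the
  Gaertner-Ellis theorem. The upper bound is Chernoff's inequality on two half-lines. For the lower
  bound at a point where the supremum defining \<open>\<Lambda>\<^sup>*\<close> is attained, say at \<open>a\<close>, one tilts by \<open>exp (n * a * x)\<close>;
  that the tilted laws concentrate follows from Chernoff's inequality again and differentiability of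
  \<open>\<Lambda>\<close> at \<open>a\<close>. Centering gives \<open>\<Lambda> \<ge> 0\<close>, and then such points are dense enough in the domain
  of \<open>\<Lambda>\<^sup>*\<close>.
\<close>

section \<open>Fenchel-Legendre transforms of nonnegative functions\<close>

lemma fenchel_legendre_ge: "ereal (l * x - L l) \<le> fenchel_legendre L x"
  unfolding fenchel_legendre_def by (rule SUP_upper) simp

lemma fenchel_legendre_leI:
  assumes "\<And>l. ereal (l * x - L l) \<le> r"
  shows "fenchel_legendre L x \<le> r"
  unfolding fenchel_legendre_def by (rule SUP_least) (rule assms)

text \<open>Testing with \<open>l = 0\<close> gives nonnegativity, and \<open>0 \<le> L\<close>
  makes the transform vanish at \<open>0\<close>. A level set is an intersection of closed sets, one
  for each \<open>l\<close>; the slopes \<open>1\<close> and \<open>-1\<close> alone already bound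
  it.\<close>

lemma good_rate_function_fenchel_legendre:
  assumes "L 0 = 0" and "\<And>l. 0 \<le> L l"
  shows "good_rate_function (fenchel_legendre L)"
  unfolding good_rate_function_def
proof (intro conjI allI impI)
  show "0 \<le> fenchel_legendre L x" for x
    using fenchel_legendre_ge[of 0 x L] assms(1) by (simp add: zero_ereal_def)
  have "fenchel_legendre L 0 \<le> 0"
    using assms(2) by (intro fenchel_legendre_leI) simp
  then show "\<exists>x. fenchel_legendre L x \<noteq> \<infinity>"
    by (intro exI[of _ 0]) auto
  fix c :: real
  have eq: "{x. fenchel_legendre L x \<le> ereal c} = (\<Inter>l. {x. l * x - L l \<le> c})"
    by (auto simp: fenchel_legendre_def SUP_le_iff)
  have "closed {x. fenchel_legendre L x \<le> ereal c}"
    unfolding eq by (intro closed_INT ballI closed_Collect_le continuous_intros)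
  moreover have "{x. fenchel_legendre L x \<le> ereal c} \<subseteq> {- (c + L (-1))..c + L 1}"
  proof
    fix x assume "x \<in> {x. fenchel_legendre L x \<le> ereal c}"
    then have "l * x - L l \<le> c" for l
      unfolding eq by blast
    from this[of 1] this[of "-1"] show "x \<in> {- (c + L (-1))..c + L 1}"
      by simp
  qed
  then have "bounded {x. fenchel_legendre L x \<le> ereal c}"
    using bounded_closed_interval bounded_subset by blast
  ultimately show "compact {x. fenchel_legendre L x \<le> ereal c}"
    by (simp add: compact_eq_bounded_closed)
qed

text \<open>Shrinking a point \<open>x\<close> of finite rate towards \<open>0\<close> makes \<open>\<lambda>l. l * y - L l\<close> tend to \<open>-\<infinity>\<close> on
  both sides, so the supremum is attained; this avoids convex duality altogether.\<close>

lemma fenchel_legendre_attained_nearby: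
  assumes L0: "L 0 = 0" and L_nonneg: "\<And>l. 0 \<le> L l" and cont: "continuous_on UNIV L"
    and fin: "fenchel_legendre L x \<le> ereal r" and "0 < e"
  obtains y a where "\<bar>y - x\<bar> < e" "\<And>l. l * y - L l \<le> a * y - L a" "a * y - L a \<le> r"
proof (cases "x = 0")
  case True
  have "0 \<le> r"
    using order_trans[OF fenchel_legendre_ge[of 0 x L] fin] L0 by simp
  then show ?thesis
    using that[of 0 0] True L0 L_nonneg \<open>0 < e\<close> by simp
next
  case False
  have r: "l * x - L l \<le> r" for l
    using order_trans[OF fenchel_legendre_ge[of l x L] fin] by simp
  have "0 \<le> r"
    using r[of 0] L0 by simp
  \<comment> \<open>The second entry keeps the displacement \<open>t * \<bar>x\<bar>\<close> below
    \<open>e\<close>; the cap \<open>1/2\<close> keeps \<open>1 - t\<close> positive.\<close>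
  define t where "t = min (1/2) (e / (2 * \<bar>x\<bar>))"
  have t: "0 < t" "t \<le> 1/2"
    using False \<open>0 < e\<close> by (auto simp: t_def)
  have "t * \<bar>x\<bar> \<le> e / (2 * \<bar>x\<bar>) * \<bar>x\<bar>"
    by (intro mult_right_mono) (auto simp: t_def)
  then have tx: "t * \<bar>x\<bar> < e"
    using False \<open>0 < e\<close> by simp
  define y where "y = (1 - t) * x"
  define R where "R = r / (t * \<bar>x\<bar>)"
  have "0 \<le> R"
    using \<open>0 \<le> r\<close> t by (simp add: R_def)
  \<comment> \<open>If \<open>l * x\<close> is nonnegative, passing from \<open>x\<close> to
    \<open>y\<close> lowers the objective by \<open>t * \<bar>l\<bar> * \<bar>x\<bar>\<close>, which
    exceeds \<open>r\<close> once \<open>\<bar>l\<bar>\<close> exceeds \<open>R\<close>. Otherwise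
    \<open>l * y \<le> 0\<close> and \<open>L \<ge> 0\<close> suffice. Since \<open>l = 0\<close>
    gives the value \<open>0\<close>, a maximum over \<open>{-R..R}\<close> is global.\<close>
  have outside: "l * y - L l \<le> 0" if "R < \<bar>l\<bar>" for l
  proof (cases "l * x \<ge> 0")
    case True
    have "r < \<bar>l\<bar> * (t * \<bar>x\<bar>)"
      using that False t by (simp add: R_def field_simps)
    also have "\<bar>l\<bar> * (t * \<bar>x\<bar>) = t * (l * x)"
      using True by (simp add: abs_mult[symmetric])
    finally show ?thesis
      using r[of l] by (simp add: y_def algebra_simps)
  next
    case False
    have "(1 - t) * (l * x) \<le> 0"
      by (rule mult_nonneg_nonpos) (use False t in linarith)+
    then show ?thesis
      using L_nonneg[of l] by (simp add: y_def algebra_simps)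
  qed
  have "\<exists>a\<in>{-R..R}. \<forall>l\<in>{-R..R}. l * y - L l \<le> a * y - L a"
    using \<open>0 \<le> R\<close>
    by (intro continuous_attains_sup continuous_intros continuous_on_subset[OF cont]) auto
  then obtain a where a: "\<forall>l\<in>{-R..R}. l * y - L l \<le> a * y - L a" ..
  then have a: "l * y - L l \<le> a * y - L a" if "\<bar>l\<bar> \<le> R" for l
    using that by (simp add: abs_le_iff)
  have "0 \<le> a * y - L a"
    using a[of 0] \<open>0 \<le> R\<close> L0 by simp
  then have max: "l * y - L l \<le> a * y - L a" for l
    using a[of l] outside[of l] by (cases "\<bar>l\<bar> \<le> R") auto
  have "a * y - L a \<le> (1 - t) * (a * x - L a)"
    using L_nonneg[of a] t by (simp add: y_def algebra_simps)
  also have "\<dots> \<le> (1 - t) * r"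
    using r[of a] t by (intro mult_left_mono) auto
  also have "\<dots> \<le> r"
    using \<open>0 \<le> r\<close> t by (simp add: algebra_simps)
  finally have "a * y - L a \<le> r" .
  moreover have "\<bar>y - x\<bar> < e"
    using tx t by (simp add: y_def algebra_simps abs_mult)
  ultimately show ?thesis
    using that max by blast
qed

section \<open>Exponential bounds as bounds on normalised logarithms\<close>

lemma log_ereal_le:
  assumes "0 < t" "0 \<le> q" "q \<le> exp (t * b)"
  shows "ereal (1 / t) * log_ereal q \<le> ereal b"
proof (cases "q = 0")
  case False
  then have "ln q \<le> t * b"
    using assms by (metis ln_exp ln_mono exp_gt_zero less_eq_real_def)
  then show ?thesis
    using False assms by (simp add: log_ereal_def field_simps)
qed (use assms in \<open>simp add: log_ereal_def\<close>)

lemma log_ereal_ge: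
  assumes "0 < t" "exp (t * b) \<le> q"
  shows "ereal b \<le> ereal (1 / t) * log_ereal q"
proof -
  have "0 < q"
    using assms(2) exp_gt_zero less_le_trans by blast
  then have "t * b \<le> ln q"
    using assms by (simp add: ln_ge_iff)
  then show ?thesis
    using \<open>0 < q\<close> assms by (simp add: log_ereal_def field_simps)
qed

section \<open>Gaertner-Ellis on the real line: cumulants and exponential tails\<close>

text \<open>The speed \<open>s\<close> is general. \<open>L\<close> is finite and differentiable on
  the whole line, so no boundary of its domain has to be treated; \<open>L_nonneg\<close> is the
  trace that centering leaves on the limit.\<close>

locale gaertner_ellis = prob_space M for M :: "'a measure" +
  fixes Z :: "nat \<Rightarrow> 'a \<Rightarrow> real" and s :: "nat \<Rightarrow> real" and L :: "real \<Rightarrow> real"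
  assumes measurable_Z: "\<And>n. n \<ge> 1 \<Longrightarrow> Z n \<in> borel_measurable M"
    and s_pos: "\<And>n. n \<ge> 1 \<Longrightarrow> 0 < s n"
    and s_at_top: "filterlim s at_top sequentially"
    and integrable_exp: "\<And>n l. n \<ge> 1 \<Longrightarrow> integrable M (\<lambda>\<omega>. exp (l * Z n \<omega>))"
    and cumulant_lim: "\<And>l. (\<lambda>n. ln (mgf M (Z n) (s n * l)) / s n) \<longlonglongrightarrow> L l"
    and L_nonneg: "\<And>l. 0 \<le> L l"
    and L_differentiable: "\<And>l. L differentiable (at l)"
begin

lemma mgf_pos:
  assumes "n \<ge> 1"
  shows "0 < mgf M (Z n) l"
proof -
  have "(\<integral>\<omega>. exp (l * Z n \<omega>) \<partial>M) \<noteq> 0"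
    using integral_nonneg_eq_0_iff_AE[OF integrable_exp[OF assms, of l]] by simp
  moreover have "(\<integral>\<omega>. exp (l * Z n \<omega>) \<partial>M) \<ge> 0"
    by (rule Bochner_Integration.integral_nonneg) simp
  ultimately show ?thesis
    unfolding mgf_def by linarith
qed

lemma L_0: "L 0 = 0"
proof -
  have "(\<lambda>n. 0) \<longlonglongrightarrow> L 0"
    using cumulant_lim[of 0] by (simp add: mgf_def prob_space)
  then show ?thesis
    using LIMSEQ_unique tendsto_const by blast
qed

lemma eventually_mgf_le:
  assumes "L l < b"
  shows "\<forall>\<^sub>F n in sequentially. mgf M (Z n) (s n * l) \<le> exp (s n * b)"
  using order_tendstoD(2)[OF cumulant_lim assms] eventually_ge_at_top[of 1]
proof eventually_elim
  case (elim n)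
  then have "ln (mgf M (Z n) (s n * l)) \<le> s n * b"
    using s_pos[of n] by (simp add: field_simps)
  then show ?case
    using mgf_pos[of n "s n * l"] elim by (metis exp_le_cancel_iff exp_ln)
qed

lemma eventually_mgf_ge:
  assumes "b < L l"
  shows "\<forall>\<^sub>F n in sequentially. exp (s n * b) \<le> mgf M (Z n) (s n * l)"
  using order_tendstoD(1)[OF cumulant_lim assms] eventually_ge_at_top[of 1]
proof eventually_elim
  case (elim n)
  then have "s n * b \<le> ln (mgf M (Z n) (s n * l))"
    using s_pos[of n] by (simp add: field_simps)
  then show ?case
    using mgf_pos[of n "s n * l"] elim by (simp add: ln_ge_iff)
qed

text \<open>Chernoff's bound under the exponential tilt by \<open>a\<close>; the sign of \<open>c\<close> selects the tail.\<close>

lemma eventually_tilted_tail_le: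
  assumes "L (a + c) - c * x < b"
  shows "\<forall>\<^sub>F n in sequentially.
    (\<integral>\<omega>. exp (s n * a * Z n \<omega>) * indicator {\<omega>. c * x \<le> c * Z n \<omega>} \<omega> \<partial>M) \<le> exp (s n * b)"
proof -
  have "\<forall>\<^sub>F n in sequentially. mgf M (Z n) (s n * (a + c)) \<le> exp (s n * (b + c * x))"
    using assms by (intro eventually_mgf_le) simp
  then show ?thesis
    using eventually_ge_at_top[of 1]
  proof eventually_elim
    case (elim n)
    note [measurable] = measurable_Z[OF elim(2)]
    have "(\<integral>\<omega>. exp (s n * a * Z n \<omega>) * indicator {\<omega>. c * x \<le> c * Z n \<omega>} \<omega> \<partial>M)
        \<le> (\<integral>\<omega>. exp (- (s n * (c * x))) * exp (s n * (a + c) * Z n \<omega>) \<partial>M)"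
    proof (rule integral_mono)
      show "integrable M (\<lambda>\<omega>. exp (s n * a * Z n \<omega>) * indicator {\<omega>. c * x \<le> c * Z n \<omega>} \<omega>)"
        by (rule Bochner_Integration.integrable_bound[OF integrable_exp[OF elim(2), of "s n * a"]])
          (auto split: split_indicator)
      show "integrable M (\<lambda>\<omega>. exp (- (s n * (c * x))) * exp (s n * (a + c) * Z n \<omega>))"
        by (intro integrable_mult_right integrable_exp elim(2))
      fix \<omega>
      \<comment> \<open>On the event, \<open>s n * c * (Z n \<omega> - x)\<close> is nonnegative, so
        adding it to the exponent only enlarges the integrand and moves the tilt from
        \<open>a\<close> to \<open>a + c\<close>.\<close>
      have "s n * (c * x) \<le> s n * (c * Z n \<omega>)" if "c * x \<le> c * Z n \<omega>"
        using mult_left_mono[OF that less_imp_le[OF s_pos[OF elim(2)]]] .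
      then show "exp (s n * a * Z n \<omega>) * indicator {\<omega>. c * x \<le> c * Z n \<omega>} \<omega>
          \<le> exp (- (s n * (c * x))) * exp (s n * (a + c) * Z n \<omega>)"
        by (auto simp: exp_add[symmetric] algebra_simps split: split_indicator)
    qed
    also have "\<dots> = exp (- (s n * (c * x))) * mgf M (Z n) (s n * (a + c))"
      by (simp add: mgf_def)
    also have "\<dots> \<le> exp (- (s n * (c * x))) * exp (s n * (b + c * x))"
      using elim(1) by simp
    also have "\<dots> = exp (s n * b)"
      by (simp add: exp_add[symmetric] algebra_simps)
    finally show ?case .
  qed
qed

text \<open>Lets any constant factor be absorbed by an arbitrarily small loss in the exponential
  rate.\<close>

lemma eventually_exp_ge:
  assumes "0 < c"
  shows "\<forall>\<^sub>F n in sequentially. C \<le> exp (s n * c)"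
proof -
  have "filterlim (\<lambda>n. exp (s n * c)) at_top sequentially"
    by (intro filterlim_compose[OF exp_at_top] filterlim_at_top_mult_tendsto_pos[OF tendsto_const assms]
        s_at_top)
  then show ?thesis
    by (simp add: filterlim_at_top)
qed

section \<open>The upper bound for closed sets\<close>

lemma eventually_half_line_le:
  assumes "b < l * x - L l"
  shows "\<forall>\<^sub>F n in sequentially. measure M {\<omega> \<in> space M. l * x \<le> l * Z n \<omega>} \<le> exp (- (s n * b))"
proof -
  have "\<forall>\<^sub>F n in sequentially.
    (\<integral>\<omega>. exp (s n * 0 * Z n \<omega>) * indicator {\<omega>. l * x \<le> l * Z n \<omega>} \<omega> \<partial>M) \<le> exp (s n * (- b))"
    using assms by (intro eventually_tilted_tail_le) simp
  then show ?thesis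
    using eventually_ge_at_top[of 1]
  proof eventually_elim
    case (elim n)
    note [measurable] = measurable_Z[OF elim(2)]
    have "{\<omega>. l * x \<le> l * Z n \<omega>} \<inter> space M = {\<omega> \<in> space M. l * x \<le> l * Z n \<omega>}"
      by auto
    then show ?case
      using elim(1) by simp
  qed
qed


text \<open>The second condition on \<open>F\<close> puts it on one side of \<open>0\<close>. It
  then lies in the half-line starting at its point nearest to \<open>0\<close>, and Chernoff's bound
  at that single point is enough.\<close>

lemma eventually_one_sided_le:
  assumes F: "closed F" "\<And>x y. x \<in> F \<Longrightarrow> y \<in> F \<Longrightarrow> 0 \<le> x * y"
    and b: "\<And>x. x \<in> F \<Longrightarrow> ereal b < fenchel_legendre L x" "0 \<le> b"
  shows "\<forall>\<^sub>F n in sequentially. measure M {\<omega> \<in> space M. Z n \<omega> \<in> F} \<le> exp (- (s n * b))"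
proof (cases "F = {}")
  case False
  then obtain x where x: "x \<in> F" "\<And>y. y \<in> F \<Longrightarrow> \<bar>x\<bar> \<le> \<bar>y\<bar>"
    using distance_attains_inf[OF F(1), of 0] by auto
  obtain l where l: "b < l * x - L l"
    using b(1)[OF x(1)] by (auto simp: fenchel_legendre_def less_SUP_iff)
  \<comment> \<open>\<open>L\<close> and \<open>b\<close> being nonnegative, \<open>l\<close> has
    the sign of \<open>x\<close>, so the half-line points away from \<open>0\<close> and contains
    \<open>F\<close>.\<close>
  then have "0 < l * x"
    using L_nonneg[of l] b(2) by simp
  have *: "l * x \<le> l * y" if "y \<in> F" for y
    using \<open>0 < l * x\<close> x(2)[OF that] F(2)[OF x(1) that]
    by (auto simp: zero_less_mult_iff zero_le_mult_iff mult_le_cancel_left)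
  show ?thesis
    using eventually_half_line_le[OF l] eventually_ge_at_top[of 1]
  proof eventually_elim
    case (elim n)
    note [measurable] = measurable_Z[OF elim(2)]
    have "measure M {\<omega> \<in> space M. Z n \<omega> \<in> F} \<le> measure M {\<omega> \<in> space M. l * x \<le> l * Z n \<omega>}"
      using * by (intro finite_measure_mono) auto
    then show ?case
      using elim(1) by simp
  qed
qed simp

text \<open>Cutting \<open>F\<close> at \<open>0\<close> gives two one-sided sets; the gap between
  \<open>c\<close> and \<open>b\<close> absorbs the resulting factor \<open>2\<close>. For negative
  \<open>b\<close> the bound exceeds \<open>1\<close> and is trivial.\<close>

lemma eventually_closed_le:
  assumes F: "closed F" and b: "\<And>x. x \<in> F \<Longrightarrow> ereal b < fenchel_legendre L x" and "c < b"
  shows "\<forall>\<^sub>F n in sequentially. measure M {\<omega> \<in> space M. Z n \<omega> \<in> F} \<le> exp (- (s n * c))"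
proof (cases "0 \<le> b")
  case True
  have "\<forall>\<^sub>F n in sequentially. measure M {\<omega> \<in> space M. Z n \<omega> \<in> F \<inter> {0..}} \<le> exp (- (s n * b))"
    using F b True by (intro eventually_one_sided_le) auto
  moreover
  have "\<forall>\<^sub>F n in sequentially. measure M {\<omega> \<in> space M. Z n \<omega> \<in> F \<inter> {..0}} \<le> exp (- (s n * b))"
    using F b True by (intro eventually_one_sided_le) (auto simp: mult_nonpos_nonpos)
  moreover have "\<forall>\<^sub>F n in sequentially. 2 \<le> exp (s n * (b - c))"
    using \<open>c < b\<close> by (intro eventually_exp_ge) simp
  ultimately show ?thesis
    using eventually_ge_at_top[of 1]
  proof eventually_elim
    case (elim n)
    note [measurable] = measurable_Z[OF elim(4)]
    have [measurable]: "F \<in> sets borel"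
      using F by (rule borel_closed)
    have "{\<omega> \<in> space M. Z n \<omega> \<in> F}
        = {\<omega> \<in> space M. Z n \<omega> \<in> F \<inter> {0..}} \<union> {\<omega> \<in> space M. Z n \<omega> \<in> F \<inter> {..0}}"
      by auto
    then have "measure M {\<omega> \<in> space M. Z n \<omega> \<in> F} \<le> measure M {\<omega> \<in> space M. Z n \<omega> \<in> F \<inter> {0..}}
        + measure M {\<omega> \<in> space M. Z n \<omega> \<in> F \<inter> {..0}}"
      by (simp only:) (rule measure_Un_le; measurable)
    also have "\<dots> \<le> 2 * exp (- (s n * b))"
      using elim(1,2) by simp
    also have "\<dots> \<le> exp (s n * (b - c)) * exp (- (s n * b))"
      using elim(3) by simp
    also have "\<dots> = exp (- (s n * c))"
      by (simp add: exp_add[symmetric] algebra_simps)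
    finally show ?case .
  qed
next
  case False
  show ?thesis
    using eventually_ge_at_top[of 1]
  proof eventually_elim
    case (elim n)
    have "s n * c \<le> 0"
      using s_pos[OF elim] False \<open>c < b\<close> by (intro mult_nonneg_nonpos) auto
    then have "1 \<le> exp (- (s n * c))"
      by simp
    then show ?case
      using prob_le_1 order_trans by blast
  qed
qed

section \<open>The lower bound for open sets\<close>

text \<open>Change of measure: weighted by \<open>exp (s n * a * Z n \<omega>)\<close>, the two
  tails outside the ball are negligible against the total mass, which grows at rate
  \<open>L a\<close>, and inside the ball the weight is nearly constant. Of the error,
  \<open>\<bar>a\<bar> * e\<close> is the variation of the tilt over the ball, one \<open>e\<close>
  comes from approximating \<open>L a\<close>, and one from discarding half of the mass.\<close>

lemma eventually_ball_ge_exposed: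
  assumes max: "\<And>l. l * y - L l \<le> a * y - L a" and "0 < e"
  shows "\<forall>\<^sub>F n in sequentially.
    exp (- (s n * (a * y - L a + (2 + \<bar>a\<bar>) * e))) \<le> measure M {\<omega> \<in> space M. \<bar>Z n \<omega> - y\<bar> < e}"
proof -
  obtain D where D: "(L has_real_derivative D) (at a)"
    using L_differentiable real_differentiable_def by blast
  have "((\<lambda>l. l * y - L l) has_real_derivative y - D) (at a)"
    by (auto intro!: derivative_eq_intros D)
  \<comment> \<open>First-order condition: \<open>a\<close> maximises the objective, so the
    derivative of \<open>L\<close> at \<open>a\<close> is \<open>y\<close>.\<close>
  then have "y - D = 0"
    using max by (intro DERIV_local_max[of "\<lambda>l. l * y - L l" _ a 1]) auto
  then have lim: "(\<lambda>h. (L (a + h) - L a) / h) \<midarrow>0\<rightarrow> y"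
    using D by (simp add: DERIV_def)
  obtain k where "0 < k"
    and k: "\<And>h. h \<noteq> 0 \<Longrightarrow> \<bar>h\<bar> < k \<Longrightarrow> \<bar>(L (a + h) - L a) / h - y\<bar> < e"
    using LIM_D[OF lim \<open>0 < e\<close>] by auto
  define c where "c = k / 2"
  have "0 < c" "c < k"
    using \<open>0 < k\<close> by (auto simp: c_def)
  have "(L (a + c) - L a) / c < y + e" "y - e < (L (a + - c) - L a) / - c"
    using k[of c] k[of "- c"] \<open>0 < c\<close> \<open>c < k\<close> by linarith+
  \<comment> \<open>Moving the tilt by a small \<open>c\<close> to either side changes
    \<open>L\<close> by about \<open>c * y\<close>, whereas the tails start at distance
    \<open>e\<close> from \<open>y\<close>; hence both Chernoff exponents fall strictly below
    \<open>L a\<close>.\<close>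
  then have "L (a + c) - c * (y + e) < L a" "L (a + - c) - - c * (y - e) < L a"
    using \<open>0 < c\<close> by (simp_all add: field_simps)
  then obtain b where b: "L (a + c) - c * (y + e) < b" "L (a + - c) - - c * (y - e) < b" "b < L a"
    using dense[of "max (L (a + c) - c * (y + e)) (L (a + - c) - - c * (y - e))" "L a"] by auto
  obtain b' where b': "b < b'" "L a - e < b'" "b' < L a"
    using dense[of "max b (L a - e)" "L a"] b(3) \<open>0 < e\<close> by auto
  \<comment> \<open>With the factor \<open>4\<close> each tail takes at most a quarter of
    \<open>exp (s n * b')\<close>, so half remains; the factor \<open>2\<close> below turns this
    half into a loss of \<open>e\<close> in the exponent.\<close>
  have "\<forall>\<^sub>F n in sequentially. 4 \<le> exp (s n * (b' - b))"
    using b' by (intro eventually_exp_ge) simp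
  moreover have "\<forall>\<^sub>F n in sequentially. 2 \<le> exp (s n * e)"
    using \<open>0 < e\<close> by (rule eventually_exp_ge)
  ultimately show ?thesis
    using eventually_mgf_ge[OF b'(3)] eventually_tilted_tail_le[OF b(1)]
      eventually_tilted_tail_le[OF b(2)] eventually_ge_at_top[of 1]
  proof eventually_elim
    case (elim n)
    note [measurable] = measurable_Z[OF elim(6)]
    have sn: "0 < s n"
      using elim(6) by (rule s_pos)
    let ?f = "\<lambda>\<omega>. exp (s n * a * Z n \<omega>)"
    let ?A = "{\<omega>. c * (y + e) \<le> c * Z n \<omega>}" and ?B = "{\<omega>. - c * (y - e) \<le> - c * Z n \<omega>}"
    let ?C = "{\<omega> \<in> space M. \<bar>Z n \<omega> - y\<bar> < e}" and ?u = "exp (s n * (a * y + \<bar>a\<bar> * e))"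
    have int: "integrable M ?f"
      by (rule integrable_exp[OF elim(6)])
    have intA: "integrable M (\<lambda>\<omega>. ?f \<omega> * indicator ?A \<omega>)"
      by (rule Bochner_Integration.integrable_bound[OF int]) (auto split: split_indicator)
    have intB: "integrable M (\<lambda>\<omega>. ?f \<omega> * indicator ?B \<omega>)"
      by (rule Bochner_Integration.integrable_bound[OF int]) (auto split: split_indicator)
    have "4 * exp (s n * b) \<le> exp (s n * (b' - b)) * exp (s n * b)"
      using elim(1) by simp
    also have "\<dots> = exp (s n * b')"
      by (simp add: exp_add[symmetric] algebra_simps)
    finally have 1: "4 * exp (s n * b) \<le> exp (s n * b')" .
    have "2 * exp (s n * (b' - e)) \<le> exp (s n * e) * exp (s n * (b' - e))"
      using elim(2) by simp
    also have "\<dots> = exp (s n * b')"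
      by (simp add: exp_add[symmetric] algebra_simps)
    finally have "exp (s n * (b' - e)) \<le> exp (s n * b') - exp (s n * b) - exp (s n * b)"
      using 1 by simp
    also have "\<dots> \<le> integral\<^sup>L M ?f - (\<integral>\<omega>. ?f \<omega> * indicator ?A \<omega> \<partial>M)
        - (\<integral>\<omega>. ?f \<omega> * indicator ?B \<omega> \<partial>M)"
      using elim(3,4,5) by (simp add: mgf_def)
    also have "\<dots> = (\<integral>\<omega>. ?f \<omega> - ?f \<omega> * indicator ?A \<omega> - ?f \<omega> * indicator ?B \<omega> \<partial>M)"
      using int intA intB by simp
    also have "\<dots> \<le> (\<integral>\<omega>. ?u * indicator ?C \<omega> \<partial>M)"
    proof (rule integral_mono)
      show "integrable M (\<lambda>\<omega>. ?f \<omega> - ?f \<omega> * indicator ?A \<omega> - ?f \<omega> * indicator ?B \<omega>)"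
        using int intA intB by simp
      show "integrable M (\<lambda>\<omega>. ?u * indicator ?C \<omega>)"
        by (intro integrable_mult_right integrable_real_indicator) (auto simp: emeasure_eq_measure)
      fix \<omega> assume \<omega>: "\<omega> \<in> space M"
      \<comment> \<open>Outside the ball at least one of the two tail events occurs, so the left
        side is at most \<open>0\<close>; inside, it is at most the tilt, which \<open>?u\<close>
        bounds.\<close>
      show "?f \<omega> - ?f \<omega> * indicator ?A \<omega> - ?f \<omega> * indicator ?B \<omega> \<le> ?u * indicator ?C \<omega>"
      proof (cases "\<bar>Z n \<omega> - y\<bar> < e")
        case True
        have "a * (Z n \<omega> - y) \<le> \<bar>a\<bar> * \<bar>Z n \<omega> - y\<bar>"
          by (metis abs_ge_self abs_mult)
        also have "\<dots> \<le> \<bar>a\<bar> * e"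
          using True by (intro mult_left_mono) auto
        finally have "s n * (a * Z n \<omega>) \<le> s n * (a * y + \<bar>a\<bar> * e)"
          using sn by (intro mult_left_mono) (auto simp: algebra_simps)
        then have le: "?f \<omega> \<le> ?u"
          by (simp add: mult.assoc)
        have "?f \<omega> - ?f \<omega> * indicator ?A \<omega> - ?f \<omega> * indicator ?B \<omega> \<le> ?f \<omega>"
          by (simp split: split_indicator)
        also note le
        also have "?u = ?u * indicator ?C \<omega>"
          using True \<omega> by simp
        finally show ?thesis .
      next
        case False
        then have "\<omega> \<in> ?A \<or> \<omega> \<in> ?B"
          using \<open>0 < c\<close> by auto
        then show ?thesis
          using False by (auto split: split_indicator)
      qed
    qed
    also have "\<dots> = ?u * measure M ?C"
      by (simp add: Int_absorb1)
    finally have "exp (s n * (b' - e)) / ?u \<le> measure M ?C"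
      by (simp add: field_simps)
    moreover have "exp (- (s n * (a * y - L a + (2 + \<bar>a\<bar>) * e))) \<le> exp (s n * (b' - e)) / ?u"
    proof -
      have "s n * (- (a * y - L a + (2 + \<bar>a\<bar>) * e)) \<le> s n * (b' - e - (a * y + \<bar>a\<bar> * e))"
        using b'(2) sn by (intro mult_left_mono) (auto simp: algebra_simps)
      then show ?thesis
        by (simp add: exp_diff[symmetric] algebra_simps)
    qed
    ultimately show ?case
      by simp
  qed
qed

text \<open>The supremum at \<open>x\<close> itself need not be attained, so \<open>x\<close> is
  replaced by a nearby point \<open>y\<close> where it is, with rate at most \<open>r'\<close>. The
  reserve \<open>r - r'\<close> pays for the error of the ball estimate.\<close>

lemma eventually_open_ge:
  assumes "open U" "x \<in> U" and fin: "fenchel_legendre L x < ereal r"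
    and [measurable]: "G \<in> sets borel" and "U \<subseteq> G"
  shows "\<forall>\<^sub>F n in sequentially. exp (- (s n * r)) \<le> measure M {\<omega> \<in> space M. Z n \<omega> \<in> G}"
proof -
  obtain r' where r': "fenchel_legendre L x < ereal r'" "r' < r"
    using ereal_dense2[OF fin] by auto
  obtain \<epsilon> where \<epsilon>: "0 < \<epsilon>" "\<And>z. \<bar>z - x\<bar> < \<epsilon> \<Longrightarrow> z \<in> U"
    using assms(1,2) by (auto simp: open_real)
  have "continuous_on UNIV L"
    using L_differentiable differentiable_imp_continuous_within
    by (auto simp: continuous_on_eq_continuous_within)
  then obtain y a where y: "\<bar>y - x\<bar> < \<epsilon> / 2"
    and max: "\<And>l. l * y - L l \<le> a * y - L a" and le: "a * y - L a \<le> r'"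
    using fenchel_legendre_attained_nearby[OF L_0 L_nonneg _ less_imp_le[OF r'(1)], of "\<epsilon> / 2"] \<epsilon>(1)
    by (metis half_gt_zero)
  \<comment> \<open>Chosen after \<open>a\<close>: the ball around \<open>y\<close> stays within
    \<open>\<epsilon>\<close> of \<open>x\<close>, and \<open>(2 + \<bar>a\<bar>) * e\<close> is at
    most \<open>r - r'\<close>.\<close>
  define e where "e = min (\<epsilon> / 2) ((r - r') / (2 + \<bar>a\<bar>))"
  have e: "0 < e" "e \<le> \<epsilon> / 2"
    unfolding e_def using \<epsilon>(1) r'(2) by (simp add: add_pos_nonneg, intro min.cobounded1)
  have "(2 + \<bar>a\<bar>) * e \<le> (2 + \<bar>a\<bar>) * ((r - r') / (2 + \<bar>a\<bar>))"
    by (intro mult_left_mono) (auto simp: e_def)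
  then have *: "a * y - L a + (2 + \<bar>a\<bar>) * e \<le> r"
    using le by simp
  show ?thesis
    using eventually_ball_ge_exposed[OF max e(1)] eventually_ge_at_top[of 1]
  proof eventually_elim
    case (elim n)
    note [measurable] = measurable_Z[OF elim(2)]
    have "exp (- (s n * r)) \<le> exp (- (s n * (a * y - L a + (2 + \<bar>a\<bar>) * e)))"
      using * s_pos[OF elim(2)] by (simp add: mult_left_mono)
    also note elim(1)
    also have "measure M {\<omega> \<in> space M. \<bar>Z n \<omega> - y\<bar> < e} \<le> measure M {\<omega> \<in> space M. Z n \<omega> \<in> G}"
    proof (rule finite_measure_mono)
      show "{\<omega> \<in> space M. \<bar>Z n \<omega> - y\<bar> < e} \<subseteq> {\<omega> \<in> space M. Z n \<omega> \<in> G}"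
      proof safe
        fix \<omega> assume "\<bar>Z n \<omega> - y\<bar> < e"
        then have "\<bar>Z n \<omega> - x\<bar> < \<epsilon>"
          using y e(2) by linarith
        then show "Z n \<omega> \<in> G"
          using \<epsilon>(2) \<open>U \<subseteq> G\<close> by blast
      qed
    qed measurable
    finally show ?case .
  qed
qed

section \<open>From exponential estimates to the large deviation principle\<close>

theorem satisfies_LDP: "satisfies_LDP M Z s (fenchel_legendre L)"
  unfolding satisfies_LDP_def
proof (intro conjI ballI allI impI)
  show "good_rate_function (fenchel_legendre L)"
    using L_0 L_nonneg by (rule good_rate_function_fenchel_legendre)
  fix G :: "real set" assume G: "G \<in> sets borel"
  let ?p = "\<lambda>n. measure M {\<omega> \<in> space M. Z n \<omega> \<in> G}"
  show "- (INF x\<in>interior G. fenchel_legendre L x) \<le> liminf (\<lambda>n. ereal (1 / s n) * log_ereal (?p n))"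
  \<comment> \<open>Comparison with every \<open>w\<close> strictly below the bound covers finite
    and infinite infima at once and supplies the strict inequalities that the estimates require;
    \<open>dense_ge\<close> does the same for the upper bound.\<close>
  proof (rule dense_le)
    fix w assume "w < - (INF x\<in>interior G. fenchel_legendre L x)"
    then have "(INF x\<in>interior G. fenchel_legendre L x) < - w"
      using ereal_less_uminus_reorder by blast
    then obtain x where x: "x \<in> interior G" "fenchel_legendre L x < - w"
      by (auto simp: INF_less_iff)
    then obtain r where r: "fenchel_legendre L x < ereal r" "ereal r < - w"
      using ereal_dense2 by blast
    have "\<forall>\<^sub>F n in sequentially. ereal (- r) \<le> ereal (1 / s n) * log_ereal (?p n)"
      using eventually_open_ge[OF open_interior x(1) r(1) G interior_subset] eventually_ge_at_top[of 1]
      by eventually_elim (intro log_ereal_ge, auto simp: s_pos)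
    then have "ereal (- r) \<le> liminf (\<lambda>n. ereal (1 / s n) * log_ereal (?p n))"
      by (rule Liminf_bounded)
    moreover have "w \<le> ereal (- r)"
      using r(2) by (cases w) auto
    ultimately show "w \<le> liminf (\<lambda>n. ereal (1 / s n) * log_ereal (?p n))"
      by (rule order_trans[rotated])
  qed
  show "limsup (\<lambda>n. ereal (1 / s n) * log_ereal (?p n)) \<le> - (INF x\<in>closure G. fenchel_legendre L x)"
  proof (rule dense_ge)
    fix w assume "- (INF x\<in>closure G. fenchel_legendre L x) < w"
    then have "- w < (INF x\<in>closure G. fenchel_legendre L x)"
      using ereal_uminus_less_reorder by blast
    then obtain b where b: "- w < ereal b" "ereal b < (INF x\<in>closure G. fenchel_legendre L x)"
      using ereal_dense2 by blast
    then obtain c where c: "- w < ereal c" "c < b"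
      using ereal_dense2[OF b(1)] by auto
    have "ereal b < fenchel_legendre L x" if "x \<in> closure G" for x
      using b(2) INF_lower[OF that] by (rule less_le_trans)
    then have "\<forall>\<^sub>F n in sequentially.
        measure M {\<omega> \<in> space M. Z n \<omega> \<in> closure G} \<le> exp (- (s n * c))"
      by (intro eventually_closed_le[OF closed_closure _ c(2)])
    then have "\<forall>\<^sub>F n in sequentially. ereal (1 / s n) * log_ereal (?p n) \<le> ereal (- c)"
      using eventually_ge_at_top[of 1]
    proof eventually_elim
      case (elim n)
      note [measurable] = measurable_Z[OF elim(2)] borel_closed[OF closed_closure[of G]]
      have "?p n \<le> measure M {\<omega> \<in> space M. Z n \<omega> \<in> closure G}"
        using closure_subset[of G] by (intro finite_measure_mono) auto
      then show ?case
        using elim(1) s_pos[OF elim(2)] by (intro log_ereal_le) auto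
    qed
    then have "limsup (\<lambda>n. ereal (1 / s n) * log_ereal (?p n)) \<le> ereal (- c)"
      by (rule Limsup_bounded)
    also have "ereal (- c) \<le> w"
      using c(1) by (cases w) auto
    finally show "limsup (\<lambda>n. ereal (1 / s n) * log_ereal (?p n)) \<le> w" .
  qed
qed (auto simp: measurable_Z s_pos s_at_top)

end

section \<open>Moment generating functions of bounded variables\<close>

text \<open>The quadratic remainder from which the moment generating function is
  differentiated.\<close>

lemma abs_exp_minus_one_minus_le:
  fixes u :: real
  assumes "\<bar>u\<bar> \<le> 1"
  shows "\<bar>exp u - 1 - u\<bar> \<le> u\<^sup>2"
proof -
  have "exp u \<le> 1 + u + u\<^sup>2"
  proof (cases "0 \<le> u")
    case True
    then show ?thesis
      using exp_bound assms by simp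
  next
    case False
    define v where "v = - u"
    have v: "0 < v"
      using False by (simp add: v_def)
    \<comment> \<open>The product of \<open>1 - v + v\<^sup>2\<close> with the quadratic Taylor
      polynomial of \<open>exp v\<close> is at least \<open>1\<close>, which bounds the reciprocal
      \<open>exp (- v)\<close>.\<close>
    have "1 \<le> 1 + v ^ 2 / 2 + v ^ 3 / 2 + v ^ 4 / 2"
      using v by simp
    also have "\<dots> = (1 - v + v\<^sup>2) * (1 + v + v\<^sup>2 / 2)"
      by (simp add: field_simps power2_eq_square power3_eq_cube power4_eq_xxxx)
    also have "\<dots> \<le> (1 - v + v\<^sup>2) * exp v"
    proof (rule mult_left_mono)
      show "1 + v + v\<^sup>2 / 2 \<le> exp v"
        using exp_lower_Taylor_quadratic v by simp
      show "0 \<le> 1 - v + v\<^sup>2"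
        using assms by (simp add: v_def)
    qed
    finally have "exp (- v) \<le> 1 - v + v\<^sup>2"
      by (simp add: exp_minus field_simps)
    then show ?thesis
      by (simp add: v_def)
  qed
  then show ?thesis
    using exp_ge_add_one_self[of u] zero_le_power2[of u] unfolding abs_le_iff by linarith
qed

context prob_space
begin

context
  fixes X :: "'a \<Rightarrow> real" and c :: real
  assumes X [measurable]: "X \<in> borel_measurable M"
    and bounded: "AE \<omega> in M. \<bar>X \<omega>\<bar> \<le> c"
begin

lemma AE_exp_mult_le: "AE \<omega> in M. exp (l * X \<omega>) \<le> exp (\<bar>l\<bar> * c)"
  using bounded
proof eventually_elim
  case (elim \<omega>)
  have "l * X \<omega> \<le> \<bar>l\<bar> * \<bar>X \<omega>\<bar>"
    by (metis abs_ge_self abs_mult)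
  also have "\<dots> \<le> \<bar>l\<bar> * c"
    using elim by (intro mult_left_mono) auto
  finally show ?case
    by simp
qed

lemma integrable_exp_mult_bounded: "integrable M (\<lambda>\<omega>. exp (l * X \<omega>))"
  using AE_exp_mult_le by (intro integrable_const_bound[of _ "exp (\<bar>l\<bar> * c)"]) auto

lemma integrable_bounded: "integrable M X"
  using bounded by (intro integrable_const_bound[of _ c]) auto

text \<open>Integrate \<open>1 + u \<le> exp u\<close> at \<open>u = l * X \<omega>\<close>; this is
  where centering enters.\<close>

lemma mgf_ge_one:
  assumes "expectation X = 0"
  shows "1 \<le> mgf M X l"
proof -
  have "1 = (\<integral>\<omega>. 1 + l * X \<omega> \<partial>M)"
    using integrable_bounded assms by (simp add: prob_space)
  also have "\<dots> \<le> mgf M X l"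
    unfolding mgf_def using integrable_bounded
    by (intro integral_mono integrable_exp_mult_bounded) (auto simp: exp_ge_add_one_self)
  finally show ?thesis .
qed

text \<open>The Taylor remainder is integrated directly: the difference quotient differs from the
  claimed derivative by at most \<open>\<bar>h\<bar> * K\<close>. The restriction
  \<open>\<bar>h\<bar> < 1 / c\<close> keeps \<open>h * X \<omega>\<close> in the range of the
  remainder bound.\<close>

lemma DERIV_mgf:
  assumes "0 < c"
  shows "(mgf M X has_real_derivative (\<integral>\<omega>. X \<omega> * exp (l * X \<omega>) \<partial>M)) (at l)"
proof -
  define D where "D = (\<integral>\<omega>. X \<omega> * exp (l * X \<omega>) \<partial>M)"
  define K where "K = c\<^sup>2 * exp (\<bar>l\<bar> * c)"
  have int: "integrable M (\<lambda>\<omega>. X \<omega> * exp (l * X \<omega>))"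
    using bounded AE_exp_mult_le[of l]
    by (intro integrable_const_bound[of _ "c * exp (\<bar>l\<bar> * c)"])
      (auto elim!: eventually_elim2 simp: abs_mult intro!: mult_mono)
  have bound: "norm ((mgf M X (l + h) - mgf M X l) / h - D) \<le> \<bar>h\<bar> * K" if h: "h \<noteq> 0" "\<bar>h\<bar> < 1 / c" for h
  proof -
    have "\<bar>mgf M X (l + h) - mgf M X l - h * D\<bar>
        = \<bar>\<integral>\<omega>. exp (l * X \<omega>) * (exp (h * X \<omega>) - 1 - h * X \<omega>) \<partial>M\<bar>"
      using int integrable_exp_mult_bounded[of l] integrable_exp_mult_bounded[of "l + h"]
      by (simp add: mgf_def D_def algebra_simps exp_add[symmetric])
    also have "\<dots> \<le> h\<^sup>2 * K"
    proof -
      have "AE \<omega> in M. norm (exp (l * X \<omega>) * (exp (h * X \<omega>) - 1 - h * X \<omega>)) \<le> h\<^sup>2 * K"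
        using bounded AE_exp_mult_le[of l]
      proof eventually_elim
        case (elim \<omega>)
        have "\<bar>h * X \<omega>\<bar> \<le> \<bar>h\<bar> * c"
          using elim(1) by (simp add: abs_mult mult_left_mono)
        also have "\<dots> \<le> 1"
          using h(2) assms by (simp add: field_simps)
        finally have "\<bar>exp (h * X \<omega>) - 1 - h * X \<omega>\<bar> \<le> (h * X \<omega>)\<^sup>2"
          by (rule abs_exp_minus_one_minus_le)
        also have "\<dots> \<le> h\<^sup>2 * c\<^sup>2"
          using elim(1) by (simp add: power_mult_distrib mult_left_mono abs_le_square_iff[symmetric])
        finally have "norm (exp (l * X \<omega>) * (exp (h * X \<omega>) - 1 - h * X \<omega>))
            \<le> exp (\<bar>l\<bar> * c) * (h\<^sup>2 * c\<^sup>2)"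
          using elim(2) by (simp add: abs_mult mult_mono)
        then show ?case
          by (simp add: K_def mult_ac)
      qed
      then have "(\<integral>\<omega>. norm (exp (l * X \<omega>) * (exp (h * X \<omega>) - 1 - h * X \<omega>)) \<partial>M) \<le> h\<^sup>2 * K"
        by (intro integral_le_const integrable_norm integrable_const_bound[of _ "h\<^sup>2 * K"]) auto
      from order_trans[OF integral_norm_bound this] show ?thesis
        by (simp only: real_norm_def)
    qed
    finally have "\<bar>(mgf M X (l + h) - mgf M X l - h * D) / h\<bar> \<le> h\<^sup>2 * K / \<bar>h\<bar>"
      by (simp add: divide_right_mono)
    moreover have "h\<^sup>2 * K / \<bar>h\<bar> = \<bar>h\<bar> * K"
      using h(1) by (simp add: power2_eq_square abs_if field_simps)
    moreover have "(mgf M X (l + h) - mgf M X l - h * D) / h = (mgf M X (l + h) - mgf M X l) / h - D"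
      using h(1) by (simp add: field_simps)
    ultimately show ?thesis
      by simp
  qed
  have "((\<lambda>h. (mgf M X (l + h) - mgf M X l) / h - D) \<longlongrightarrow> 0) (at 0)"
  proof (rule Lim_null_comparison)
    show "\<forall>\<^sub>F h in at 0. norm ((mgf M X (l + h) - mgf M X l) / h - D) \<le> \<bar>h\<bar> * K"
      unfolding eventually_at using bound assms by (intro exI[of _ "1 / c"]) auto
    show "((\<lambda>h. \<bar>h\<bar> * K) \<longlongrightarrow> 0) (at 0)"
      by (auto intro!: tendsto_eq_intros)
  qed
  then show ?thesis
    unfolding DERIV_def D_def by (rule LIM_zero_cancel)
qed

end

lemma
  assumes indep: "indep_vars (\<lambda>_. borel) X I" and I: "finite I"
    and bounded: "\<And>k. k \<in> I \<Longrightarrow> AE \<omega> in M. \<bar>X k \<omega>\<bar> \<le> c"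
  shows mgf_sum: "mgf M (\<lambda>\<omega>. \<Sum>k\<in>I. X k \<omega>) l = (\<Prod>k\<in>I. mgf M (X k) l)"
    and integrable_exp_sum: "integrable M (\<lambda>\<omega>. exp (l * (\<Sum>k\<in>I. X k \<omega>)))"
proof -
  have [measurable]: "X k \<in> borel_measurable M" if "k \<in> I" for k
    using indep that by (simp add: indep_vars_def)
  have *: "exp (l * (\<Sum>k\<in>I. X k \<omega>)) = (\<Prod>k\<in>I. exp (l * X k \<omega>))" for \<omega>
    using I by (simp add: sum_distrib_left exp_sum)
  have ind: "indep_vars (\<lambda>_. borel) (\<lambda>k \<omega>. exp (l * X k \<omega>)) I"
    by (rule indep_vars_compose2[OF indep]) simp
  have int: "integrable M (\<lambda>\<omega>. exp (l * X k \<omega>))" if "k \<in> I" for k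
    using that bounded by (intro integrable_exp_mult_bounded) auto
  show "mgf M (\<lambda>\<omega>. \<Sum>k\<in>I. X k \<omega>) l = (\<Prod>k\<in>I. mgf M (X k) l)"
    using indep_vars_lebesgue_integral[OF I ind int] by (simp add: mgf_def *)
  show "integrable M (\<lambda>\<omega>. exp (l * (\<Sum>k\<in>I. X k \<omega>)))"
    using indep_vars_integrable[OF I ind int] by (simp add: *)
qed

end

section \<open>Empirical means with finitely many laws\<close>

lemma mgf_eq_if_distr_eq:
  assumes "X \<in> borel_measurable M" "Y \<in> borel_measurable N" "distr M borel X = distr N borel Y"
  shows "mgf M X l = mgf N Y l"
proof -
  have "mgf M X l = (\<integral>x. exp (l * x) \<partial>distr M borel X)"
    using assms(1) by (simp add: mgf_def integral_distr)
  also have "\<dots> = mgf N Y l"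
    using assms(2) by (simp add: assms(3) mgf_def integral_distr)
  finally show ?thesis .
qed

text \<open>Each \<open>Y i\<close> lives on its own space \<open>Q i\<close> and models the common
  law of class \<open>N i\<close>. By independence the cumulant of a partial sum is the sum over
  classes of the class count times the class cumulant; dividing by \<open>n\<close> gives the limit,
  and the Gaertner-Ellis theorem applies with speed \<open>n\<close>.\<close>

theorem theorem3p3:
  fixes M :: "'a measure" and X :: "nat \<Rightarrow> 'a \<Rightarrow> real" and c0 c1 :: real
    and p :: nat and N :: "nat \<Rightarrow> nat set" and d :: "nat \<Rightarrow> real"
    and Q :: "nat \<Rightarrow> 'b measure" and Y :: "nat \<Rightarrow> 'b \<Rightarrow> real"
  assumes "prob_space M"
    and "prob_space.indep_vars M (\<lambda>_. borel) X {1..}"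
    and "\<And>k. k \<ge> 1 \<Longrightarrow> prob_space.expectation M (X k) = 0"
    and "c0 > 0" and "\<And>k. k \<ge> 1 \<Longrightarrow> AE \<omega> in M. \<bar>X k \<omega>\<bar> \<le> c0"
    and "c1 > 0" and "\<And>k. k \<ge> 1 \<Longrightarrow> prob_space.variance M (X k) \<ge> c1"
    and "(\<Union>i\<in>{1..p}. N i) = {1..}" and "disjoint_family_on N {1..p}"
    and "\<And>i. i \<in> {1..p} \<Longrightarrow> prob_space (Q i)"
    and "\<And>i. i \<in> {1..p} \<Longrightarrow> Y i \<in> borel_measurable (Q i)"
    and "\<And>i k. i \<in> {1..p} \<Longrightarrow> k \<in> N i \<Longrightarrow> distr M borel (X k) = distr (Q i) borel (Y i)"
    and "\<And>i. i \<in> {1..p} \<Longrightarrow> (\<lambda>n. real (card {k \<in> {1..n}. k \<in> N i}) / real n) \<longlonglongrightarrow> d i"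
  shows "satisfies_LDP M (\<lambda>n \<omega>. (1 / real n) * (\<Sum>k=1..n. X k \<omega>)) (\<lambda>n. real n)
           (fenchel_legendre (\<lambda>l. \<Sum>i=1..p. d i * ln (mgf (Q i) (Y i) l)))"
proof -
  interpret prob_space M by fact
  define L where "L l = (\<Sum>i=1..p. d i * ln (mgf (Q i) (Y i) l))" for l
  define Z where "Z n \<omega> = 1 / real n * (\<Sum>k=1..n. X k \<omega>)" for n \<omega>
  note bounded = assms(5)
  have X [measurable]: "X k \<in> borel_measurable M" if "k \<ge> 1" for k
    using assms(2) that by (simp add: indep_vars_def)
  have indep: "indep_vars (\<lambda>_. borel) X {1..n}" for n
    by (rule indep_vars_subset[OF assms(2)]) auto
  have N_cover: "\<exists>i\<in>{1..p}. k \<in> N i" if "1 \<le> k" for k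
    using that assms(8) by (metis UN_iff atLeast_iff)
  have N_ge: "1 \<le> k" if "i \<in> {1..p}" "k \<in> N i" for i k
    using assms(8) that by auto
  have mgf_eq: "mgf (Q i) (Y i) l = mgf M (X k) l" if "i \<in> {1..p}" "k \<in> N i" for i k l
    using that X[OF N_ge] assms(11,12) by (intro mgf_eq_if_distr_eq[symmetric]) auto
  have mgf_ge: "1 \<le> mgf M (X k) l" if "k \<ge> 1" for k l
    by (rule mgf_ge_one[OF X[OF that] bounded[OF that] assms(3)[OF that]])
  then have mgf_nz: "mgf M (X k) l \<noteq> 0" if "k \<ge> 1" for k l
    using that by (metis not_one_le_zero)
  \<comment> \<open>An empty class puts no constraint on the law of \<open>Y i\<close>, whose
    cumulant could be negative or fail to be differentiable; its weight \<open>0\<close> removes the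
    term.\<close>
  have d_empty: "d i = 0" if "i \<in> {1..p}" "N i = {}" for i
    using LIMSEQ_unique[OF assms(13)[OF that(1)]] that(2) by simp
  have d_nonneg: "0 \<le> d i" if "i \<in> {1..p}" for i
    by (rule LIMSEQ_le_const[OF assms(13)[OF that]]) auto
  have ln_mgf: "ln (mgf M (\<lambda>\<omega>. \<Sum>k=1..n. X k \<omega>) l)
      = (\<Sum>i=1..p. real (card {k \<in> {1..n}. k \<in> N i}) * ln (mgf (Q i) (Y i) l))" for n l
  proof -
    have "ln (mgf M (\<lambda>\<omega>. \<Sum>k=1..n. X k \<omega>) l) = (\<Sum>k=1..n. ln (mgf M (X k) l))"
      using mgf_nz by (subst mgf_sum[OF indep _ bounded]) (auto intro!: ln_prod)
    \<comment> \<open>Regroup the sum by classes: they cover all positive indices and are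
      disjoint.\<close>
    also have "\<dots> = (\<Sum>k\<in>(\<Union>i\<in>{1..p}. {k \<in> {1..n}. k \<in> N i}). ln (mgf M (X k) l))"
      using N_cover by (intro sum.cong refl) auto
    also have "\<dots>
        = (\<Sum>i=1..p. \<Sum>k\<in>{k \<in> {1..n}. k \<in> N i}. ln (mgf M (X k) l))"
      using assms(9) by (intro sum.UNION_disjoint) (auto simp: disjoint_family_on_def)
    also have "\<dots> = (\<Sum>i=1..p. \<Sum>k\<in>{k \<in> {1..n}. k \<in> N i}. ln (mgf (Q i) (Y i) l))"
      by (intro sum.cong refl arg_cong[of _ _ ln] mgf_eq[symmetric]) auto
    finally show ?thesis
      by simp
  qed
  interpret gaertner_ellis M Z real L
  proof
    show "Z n \<in> borel_measurable M" if "n \<ge> 1" for n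
      unfolding Z_def by measurable
    show "integrable M (\<lambda>\<omega>. exp (l * Z n \<omega>))" if "n \<ge> 1" for n l
      using integrable_exp_sum[OF indep _ bounded, of n "l / n"] by (simp add: Z_def)
    show "0 < real n" if "n \<ge> 1" for n
      using that by simp
    show "filterlim real at_top sequentially"
      by (rule filterlim_real_sequentially)
    show "(\<lambda>n. ln (mgf M (Z n) (real n * l)) / real n) \<longlonglongrightarrow> L l" for l
    proof (rule Lim_transform_eventually)
      show "(\<lambda>n. \<Sum>i=1..p. real (card {k \<in> {1..n}. k \<in> N i}) / real n * ln (mgf (Q i) (Y i) l))
          \<longlonglongrightarrow> L l"
        unfolding L_def by (intro tendsto_intros assms(13))
      show "\<forall>\<^sub>F n in sequentially.
          (\<Sum>i=1..p. real (card {k \<in> {1..n}. k \<in> N i}) / real n * ln (mgf (Q i) (Y i) l))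
          = ln (mgf M (Z n) (real n * l)) / real n"
        using eventually_ge_at_top[of 1]
      proof eventually_elim
        case (elim n)
        then have "mgf M (Z n) (real n * l) = mgf M (\<lambda>\<omega>. \<Sum>k=1..n. X k \<omega>) l"
          by (simp add: mgf_def Z_def)
        then show ?case
          by (simp only: ln_mgf sum_divide_distrib times_divide_eq_left)
      qed
    qed
    show "0 \<le> L l" for l
      unfolding L_def
    proof (rule sum_nonneg)
      fix i assume i: "i \<in> {1..p}"
      show "0 \<le> d i * ln (mgf (Q i) (Y i) l)"
      proof (cases "N i = {}")
        case False
        then obtain k where k: "k \<in> N i" by blast
        then show ?thesis
          using d_nonneg[OF i] mgf_ge[OF N_ge[OF i k]] by (simp add: mgf_eq[OF i k])
      qed (simp add: d_empty[OF i])
    qed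
    show "L differentiable (at l)" for l
      unfolding L_def
    proof (rule differentiable_sum)
      show "\<forall>i\<in>{1..p}. (\<lambda>l. d i * ln (mgf (Q i) (Y i) l)) differentiable (at l)"
      proof
        fix i assume i: "i \<in> {1..p}"
        show "(\<lambda>l. d i * ln (mgf (Q i) (Y i) l)) differentiable (at l)"
        proof (cases "N i = {}")
          case False
          \<comment> \<open>A representative \<open>X k\<close> of the class carries boundedness
            over to \<open>Y i\<close> through the equality of moment generating functions.\<close>
          then obtain k where k: "k \<in> N i" by blast
          have pos: "0 < mgf M (X k) l"
            using mgf_ge[OF N_ge[OF i k], of l] by simp
          have "((\<lambda>l. d i * ln (mgf M (X k) l)) has_real_derivative
              d i * (1 / mgf M (X k) l * (\<integral>\<omega>. X k \<omega> * exp (l * X k \<omega>) \<partial>M))) (at l)"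
            using N_ge[OF i k]
            by (intro DERIV_cmult DERIV_chain2[where f = ln and g = "mgf M (X k)"] DERIV_ln_divide pos
                DERIV_mgf[OF _ _ assms(4)] X bounded)
          then show ?thesis
            unfolding mgf_eq[OF i k] real_differentiable_def by blast
        qed (simp add: d_empty[OF i])
      qed
    qed simp
  qed
  show ?thesis
    using satisfies_LDP by (simp only: Z_def[abs_def] L_def[abs_def])
qed

end
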